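(* Let $\mathscr{P}'$ be the sub-monoid (under composition) of $\mathscr{P}$ generated by the maps $g_{p,t}$ and $h_{p,t}$ for all $p\in\mathbb{P}$ and all integers $t\ge0$. Then $\mathscr{P}'$ is dense in $\mathscr{P}$.
   Context: $\mathbb{N}=\{1,2,3,\dots\}$, $\mathbb{N}_0=\mathbb{N}\cup\{0\}$, and $\mathbb{P}$ is the set of prime numbers. For $p\in\mathbb{P}$ and $n\in\mathbb{N}$, $\mathrm{ord}_p(n)$ is the largest $k\ge0$ with $p^k\mid n$. A dynamical system is a map $T\colon X\to X$ on a set $X$ such that $\mathrm{Fix}_n(T)=|\{x\in X\mid T^nx=x\}|<\infty$ for all $n\ge1$, where $T^n$ is the $n$th iterate. Its dynamical zeta function is the formal power series $\zeta_T(z)=\exp\sum_{n\ge1}\frac{\mathrm{Fix}_n(T)}{n}z^n$, and $\mathcal{Z}$ is the set of all dynamical zeta functions of dynamical systems. For $h\colon\mathbb{N}\to\mathbb{N}$, define the formal power series $(h*\zeta_T)(z)=\exp\sum_{n\ge1}\frac{\mathrm{Fix}_{h(n)}(T)}{n}z^n$. The set $\mathscr{P}$ consists of all maps $h\colon\mathbb{N}\to\mathbb{N}$ such that $h*\zeta_T\in\mathcal{Z}$ for every dynamical system $T\colon X\to X$. It is a monoid under composition, with identity $n\mapsto n$. The space $\mathbb{N}^{\mathbb{N}}$ of all functions $\mathbb{N}\to\mathbb{N}$ carries the topology of pointwise convergence (the product topology with $\mathbb{N}$ discrete; so $h_1,h_2$ are close if $\min\{k\ge1\mid h_1(k)\ne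 h_2(k)\}$ is large), and $\mathscr{P}$ carries the subspace topology. For $p\in\mathbb{P}$ and an integer $t\ge0$, the maps $g_{p,t},h_{p,t}\colon\mathbb{N}\to\mathbb{N}$ are defined by: $g_{p,t}(n)=pn$ if $\mathrm{ord}_p(n)=t$ and $g_{p,t}(n)=n$ if $\mathrm{ord}_p(n)\ne t$; $h_{p,t}(n)=n$ if $\mathrm{ord}_p(n)<t$ and $h_{p,t}(n)=np^{t-\mathrm{ord}_p(n)}$ if $\mathrm{ord}_p(n)\ge t$. These maps belong to $\mathscr{P}$. *)

theory Defs
  imports
    "HOL-Analysis.Analysis"
    "HOL-Algebra.Group"
    "HOL-Computational_Algebra.Computational_Algebra"
begin

text \<open>
  The set \<open>{1, 2, 3, \<dots>}\<close> is \<open>posnat\<close>. Maps from it to itself are elements of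
  \<open>posnat \<rightarrow>\<^sub>E posnat\<close>, i.e. they are \<^const>\<open>undefined\<close> at \<open>0\<close>, so that equality of
  these HOL functions is equality of the maps.
\<close>

definition posnat :: "nat set" where
  "posnat = {1..}"

definition fixed_points :: "'a set \<Rightarrow> ('a \<Rightarrow> 'a) \<Rightarrow> nat \<Rightarrow> 'a set" where
  "fixed_points X T n = {x \<in> X. (T ^^ n) x = x}"

definition dynamical_system :: "'a set \<Rightarrow> ('a \<Rightarrow> 'a) \<Rightarrow> bool" where
  "dynamical_system X T \<longleftrightarrow> T \<in> X \<rightarrow> X \<and> (\<forall>n\<ge>1. finite (fixed_points X T n))"

definition Fix :: "'a set \<Rightarrow> ('a \<Rightarrow> 'a) \<Rightarrow> nat \<Rightarrow> nat" where
  "Fix X T n = card (fixed_points X T n)"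

definition exp_series :: "(nat \<Rightarrow> nat) \<Rightarrow> rat fps" where
  "exp_series a =
     fps_compose (fps_exp 1) (Abs_fps (\<lambda>n. if n = 0 then 0 else of_nat (a n) / of_nat n))"

definition zeta :: "'a set \<Rightarrow> ('a \<Rightarrow> 'a) \<Rightarrow> rat fps" where
  "zeta X T = exp_series (Fix X T)"

definition twisted_zeta :: "(nat \<Rightarrow> nat) \<Rightarrow> 'a set \<Rightarrow> ('a \<Rightarrow> 'a) \<Rightarrow> rat fps" where
  "twisted_zeta h X T = exp_series (\<lambda>n. Fix X T (h n))"

text \<open>
  A HOL definition cannot quantify over all types, so \<open>zeta_functions\<close> and
  \<open>time_changes\<close> range over the dynamical systems on sets of natural numbers. Nothing is lost,
  since only the countably many periodic points matter: the lemmas \<open>zeta_in_zeta_functions\<close> and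
  \<open>time_changes_any_type\<close> below cover dynamical systems on sets of any type.
\<close>

definition zeta_functions :: "rat fps set" where
  "zeta_functions = {zeta X T |(X :: nat set) T. dynamical_system X T}"

definition time_changes :: "(nat \<Rightarrow> nat) set" where
  "time_changes = {h \<in> posnat \<rightarrow>\<^sub>E posnat.
     \<forall>(X :: nat set) T. dynamical_system X T \<longrightarrow> twisted_zeta h X T \<in> zeta_functions}"

definition time_change_monoid :: "(nat \<Rightarrow> nat) monoid" where
  "time_change_monoid =
     \<lparr>carrier = time_changes, mult = compose posnat, one = (\<lambda>n\<in>posnat. n)\<rparr>"

definition g_map :: "nat \<Rightarrow> nat \<Rightarrow> nat \<Rightarrow> nat" where
  "g_map p t = (\<lambda>n\<in>posnat. if multiplicity p n = t then p * n else n)"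

text \<open>The division in the second case is exact; the value is \<open>n p\<^bsup>t - ord\<^sub>p(n)\<^esup>\<close>.\<close>

definition h_map :: "nat \<Rightarrow> nat \<Rightarrow> nat \<Rightarrow> nat" where
  "h_map p t =
     (\<lambda>n\<in>posnat. if multiplicity p n < t then n else n div p ^ (multiplicity p n - t))"

definition time_change_generators :: "(nat \<Rightarrow> nat) set" where
  "time_change_generators =
     {g_map p t |p t. prime p} \<union> {h_map p t |p t. prime p}"

definition generated_time_changes :: "(nat \<Rightarrow> nat) set" where
  "generated_time_changes =
     (\<lambda>H. submonoid H time_change_monoid) hull time_change_generators"

definition time_change_topology :: "(nat \<Rightarrow> nat) topology" where
  "time_change_topology =
     subtopology (product_topology (\<lambda>_. discrete_topology posnat) posnat) time_changes"

lemma funpow_in: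
  assumes "T \<in> X \<rightarrow> X" "x \<in> X"
  shows "(T ^^ n) x \<in> X"
  using assms by (induction n) auto

lemma dynamical_system_on_nat:
  fixes X :: "'a set"
  assumes "dynamical_system X T"
  obtains Y :: "nat set" and S
  where "dynamical_system Y S" "\<And>n. n \<ge> 1 \<Longrightarrow> Fix Y S n = Fix X T n"
proof -
  have TX: "T \<in> X \<rightarrow> X" and fin: "\<And>n. n \<ge> 1 \<Longrightarrow> finite (fixed_points X T n)"
    using assms by (auto simp: dynamical_system_def)
  define P where "P = (\<Union>n\<in>{1..}. fixed_points X T n)"
  have "countable P"
    unfolding P_def using fin by (intro countable_UN) (auto intro: countable_finite)
  then obtain f :: "'a \<Rightarrow> nat" where f: "inj_on f P"
    by (auto simp: countable_def)
  have PX: "P \<subseteq> X" by (auto simp: P_def fixed_points_def)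
  have TP: "T \<in> P \<rightarrow> P"
  proof
    fix x assume "x \<in> P"
    then obtain n where n: "n \<ge> 1" "x \<in> X" "(T ^^ n) x = x"
      by (auto simp: P_def fixed_points_def)
    have "(T ^^ n) (T x) = T ((T ^^ n) x)" by (simp add: funpow_swap1)
    with n TX show "T x \<in> P" by (auto simp: P_def fixed_points_def)
  qed
  define S where "S = f \<circ> T \<circ> inv_into P f"
  have S1: "S (f x) = f (T x)" if "x \<in> P" for x
    using that f by (simp add: S_def)
  have Sn: "(S ^^ n) (f x) = f ((T ^^ n) x)" if "x \<in> P" for x n
    using that by (induction n) (auto simp: S1 funpow_in[OF TP])
  have eq: "fixed_points (f ` P) S n = f ` fixed_points X T n" if "n \<ge> 1" for n
  proof -
    have "fixed_points (f ` P) S n = f ` {x \<in> P. (T ^^ n) x = x}"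
      using f funpow_in[OF TP] by (auto simp: fixed_points_def Sn inj_on_eq_iff)
    also have "{x \<in> P. (T ^^ n) x = x} = fixed_points X T n"
      using that PX by (auto simp: P_def fixed_points_def)
    finally show ?thesis .
  qed
  show thesis
  proof
    show "dynamical_system (f ` P) S"
      using TP fin by (auto simp: dynamical_system_def S1 eq)
    show "Fix (f ` P) S n = Fix X T n" if "n \<ge> 1" for n
      unfolding Fix_def eq[OF that]
      by (rule card_image, rule inj_on_subset[OF f]) (use that in \<open>auto simp: P_def\<close>)
  qed
qed

lemma exp_series_cong:
  assumes "\<And>n. n \<ge> 1 \<Longrightarrow> a n = b n"
  shows "exp_series a = exp_series b"
proof -
  have "(\<lambda>n. if n = 0 then 0 else of_nat (a n) / of_nat n :: rat) =
        (\<lambda>n. if n = 0 then 0 else of_nat (b n) / of_nat n)"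
    using assms by auto
  then show ?thesis by (simp add: exp_series_def)
qed

lemma zeta_in_zeta_functions:
  assumes "dynamical_system X T"
  shows "zeta X T \<in> zeta_functions"
proof -
  obtain Y :: "nat set" and S
    where YS: "dynamical_system Y S" "\<And>n. n \<ge> 1 \<Longrightarrow> Fix Y S n = Fix X T n"
    using dynamical_system_on_nat[OF assms] by blast
  have "zeta X T = zeta Y S"
    unfolding zeta_def using YS(2) by (intro exp_series_cong) auto
  with YS(1) show ?thesis by (auto simp: zeta_functions_def)
qed

lemma time_changes_any_type:
  assumes "h \<in> time_changes" "dynamical_system X T"
  shows "twisted_zeta h X T \<in> zeta_functions"
proof -
  obtain Y :: "nat set" and S
    where YS: "dynamical_system Y S" "\<And>n. n \<ge> 1 \<Longrightarrow> Fix Y S n = Fix X T n"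
    using dynamical_system_on_nat[OF assms(2)] by blast
  have "h n \<ge> 1" if "n \<ge> 1" for n
    using assms(1) that by (auto simp: time_changes_def posnat_def PiE_def Pi_def)
  then have "twisted_zeta h X T = twisted_zeta h Y S"
    unfolding twisted_zeta_def using YS(2) by (intro exp_series_cong) auto
  with YS(1) assms(1) show ?thesis by (auto simp: time_changes_def)
qed

end

theory Submission
  imports Defs "HOL-Combinatorics.Cycles"
begin

text \<open>
  Whether \<open>h\<close> is a time-change can be read off prime by prime. The system that consists of one
  cycle of length \<open>k\<close> has \<open>k\<close> points fixed by its \<open>n\<close>th iterate if \<open>k dvd n\<close>, and none otherwise.
  So for a time-change \<open>h\<close> there must be a system whose \<open>n\<close>th iterate fixes \<open>k\<close> points if
  \<open>k dvd h n\<close>, and none otherwise. Counting orbits in that system shows that the set of all \<open>n\<close> with \<open>k dvd h n\<close> is empty or consists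
  of the multiples of a single divisor of \<open>k\<close> (\<open>time_change_dvd_principal\<close>). Conversely,
  this condition suffices: on the points of period \<open>k\<close> of a given system one replaces the map by a
  suitable power of itself (\<open>time_change_of_dvd_principal\<close>).

  For prime powers \<open>k\<close> the condition says that the \<open>q\<close>-adic valuation of \<open>h n\<close> is a monotone
  function \<open>F q\<close> of the \<open>q\<close>-adic valuation of \<open>n\<close> alone, and that \<open>a \<le> F q a\<close> unless \<open>F q a\<close> is the
  largest value of \<open>F q\<close> (\<open>time_change_acts_on_valuations\<close>, with converse
  \<open>time_change_of_valuations\<close>). In this description time-changes compose by composing
  the functions \<open>F q\<close>, the generator \<open>g_map p t\<close> moves the single value \<open>t\<close> up by one at the
  prime \<open>p\<close>, and \<open>h_map p t\<close> truncates at \<open>t\<close>.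

  Density is then combinatorics. To agree with \<open>h\<close> on \<open>{1..N}\<close> only the primes up to
  \<open>max N (h 1)\<close> matter, and at each of them only the valuations up to \<open>N\<close>. If \<open>F q\<close> is expanding
  there, unit steps produce it, the largest argument being moved first so that no step disturbs a
  value that is already in place. Otherwise \<open>F q\<close> has a largest value \<open>J\<close> and factors as \<open>F q \<circ> min J\<close>:
  truncate at \<open>J\<close>, and then use that \<open>F q\<close> is expanding on \<open>{..J}\<close>.
\<close>

section \<open>Periodic points\<close>

lemma funpow_eq_self_iff_dvd:
  assumes "(T ^^ n\<^sub>0) x = x" "n\<^sub>0 > 0"
  shows "(T ^^ n) x = x \<longleftrightarrow> least_power T x dvd n"
proof
  assume "least_power T x dvd n"
  then show "(T ^^ n) x = x"
    using funpow_mod_eq[OF least_powerI(1)[OF assms], of n] by (simp add: mod_eq_0_iff_dvd)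
qed (rule least_power_minimal)

text \<open>
  The later point returns to \<open>x\<close> under a further iterate, so the two are fixed by the same iterates.
\<close>

lemma least_power_funpow:
  assumes "(T ^^ n\<^sub>0) x = x" "n\<^sub>0 > 0"
  shows "least_power T ((T ^^ i) x) = least_power T x"
proof -
  have "(T ^^ n) ((T ^^ i) x) = (T ^^ i) x \<longleftrightarrow> (T ^^ n) x = x" for n
  proof
    assume *: "(T ^^ n) ((T ^^ i) x) = (T ^^ i) x"
    \<comment> \<open>Since \<open>n\<^sub>0 * i\<close> is a period of \<open>x\<close>, the remaining \<open>n\<^sub>0 * i - i\<close> steps undo the first \<open>i\<close>.\<close>
    have fx: "(T ^^ (n\<^sub>0 * i)) x = x"
      using funpow_mod_eq[OF assms(1), of "n\<^sub>0 * i"] by simp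
    have "(T ^^ (n\<^sub>0 * i - i)) ((T ^^ i) x) = (T ^^ (n\<^sub>0 * i - i + i)) x"
      by (simp add: funpow_add)
    also have "n\<^sub>0 * i - i + i = n\<^sub>0 * i" using assms(2) by simp
    finally have ret: "(T ^^ (n\<^sub>0 * i - i)) ((T ^^ i) x) = x" using fx by simp
    have "(T ^^ n) x = (T ^^ (n + (n\<^sub>0 * i - i))) ((T ^^ i) x)"
      by (simp add: funpow_add ret)
    also have "\<dots> = (T ^^ (n\<^sub>0 * i - i)) ((T ^^ n) ((T ^^ i) x))"
      by (simp add: funpow_add add.commute[of n])
    also have "\<dots> = x" by (simp add: * ret)
    finally show "(T ^^ n) x = x" .
  next
    assume "(T ^^ n) x = x"
    then have "(T ^^ (i + n)) x = (T ^^ i) x" by (simp add: funpow_add)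
    then show "(T ^^ n) ((T ^^ i) x) = (T ^^ i) x" by (simp add: funpow_add add.commute[of i])
  qed
  then show ?thesis by (simp add: least_power_def)
qed

text \<open>
  The set is a union of orbits, and every orbit has exactly \<open>m\<close> points.
\<close>

lemma period_dvd_card:
  assumes "finite A" "T \<in> A \<rightarrow> A" "m > 0"
    and per: "\<And>x n. x \<in> A \<Longrightarrow> (T ^^ n) x = x \<longleftrightarrow> m dvd n"
  shows "m dvd card A"
proof -
  define r where "r = {(x, y). x \<in> A \<and> (\<exists>i. y = (T ^^ i) x)}"
  have in_A: "(T ^^ i) x \<in> A" if "x \<in> A" for x i
    by (rule funpow_in[OF assms(2) that])
  have "equiv A r"
  proof (rule equivI)
    show "r \<subseteq> A \<times> A" using in_A by (auto simp: r_def)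
    show "refl_on A r"
    proof (rule refl_onI)
      fix x assume "x \<in> A"
      moreover have "x = (T ^^ 0) x" by simp
      ultimately show "(x, x) \<in> r" unfolding r_def by blast
    qed
    show "sym r"
    proof (rule symI)
      fix x y assume "(x, y) \<in> r"
      then obtain i where x: "x \<in> A" and y: "y = (T ^^ i) x" by (auto simp: r_def)
      have "(T ^^ (m * i - i)) y = (T ^^ (m * i - i + i)) x" by (simp add: y funpow_add)
      also have "m * i - i + i = m * i" using \<open>m > 0\<close> by simp
      also have "(T ^^ (m * i)) x = x" using per[OF x] by simp
      finally have "x = (T ^^ (m * i - i)) y" by simp
      then show "(y, x) \<in> r" using in_A[OF x, of i] unfolding r_def y by blast
    qed
    show "trans r"
    proof (rule transI)
      fix x y z assume "(x, y) \<in> r" "(y, z) \<in> r"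
      then obtain i j where "x \<in> A" "z = (T ^^ j) ((T ^^ i) x)" by (auto simp: r_def)
      then have "x \<in> A" "z = (T ^^ (j + i)) x" by (simp_all add: funpow_add)
      then show "(x, z) \<in> r" unfolding r_def by blast
    qed
  qed
  moreover have "m dvd card C" if "C \<in> A // r" for C
  proof -
    obtain x where x: "x \<in> A" and C: "C = r `` {x}" using \<open>C \<in> A // r\<close> by (auto simp: quotient_def)
    have pm: "(T ^^ m) x = x" using per[OF x] by simp
    have "C = (\<lambda>i. (T ^^ i) x) ` {..<m}"
    proof
      show "C \<subseteq> (\<lambda>i. (T ^^ i) x) ` {..<m}"
      proof
        fix y assume "y \<in> C"
        then obtain i where "y = (T ^^ i) x" by (auto simp: C r_def)
        then have "y = (T ^^ (i mod m)) x" by (simp add: funpow_mod_eq[OF pm])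
        then show "y \<in> (\<lambda>i. (T ^^ i) x) ` {..<m}" using \<open>m > 0\<close> by simp
      qed
      show "(\<lambda>i. (T ^^ i) x) ` {..<m} \<subseteq> C" using x by (auto simp: C r_def)
    qed
    moreover have "inj_on (\<lambda>i. (T ^^ i) x) {..<m}"
    proof (rule linorder_inj_onI)
      fix i j assume ij: "i < j" "i \<in> {..<m}" "j \<in> {..<m}"
      show "(T ^^ i) x \<noteq> (T ^^ j) x"
      proof
        assume "(T ^^ i) x = (T ^^ j) x"
        also have "(T ^^ j) x = (T ^^ (j - i + i)) x" using ij by simp
        also have "\<dots> = (T ^^ (j - i)) ((T ^^ i) x)" by (simp only: funpow_add o_apply)
        finally have "m dvd j - i" using per[OF in_A[OF x, of i], of "j - i"] by simp
        then show False using ij by (auto dest: dvd_imp_le)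
      qed
    qed auto
    ultimately show ?thesis by (simp add: card_image)
  qed
  ultimately show ?thesis by (intro equiv_imp_dvd_card[OF \<open>finite A\<close>])
qed

section \<open>Time-changes and divisibility\<close>

text \<open>
  Composing with the logarithm series recovers the exponent, so a zeta function determines all
  numbers of periodic points.
\<close>

lemma exp_series_inj:
  assumes "exp_series a = exp_series b" "n \<ge> 1"
  shows "a n = b n"
proof -
  define A where "A c = Abs_fps (\<lambda>n. if n = 0 then 0 else of_nat (c n) / of_nat n :: rat)"
    for c :: "nat \<Rightarrow> nat"
  have A0: "A c $ 0 = 0" for c by (simp add: A_def)
  have log: "fps_ln 1 oo (exp_series c - 1) = A c" for c
  proof -
    have "exp_series c - 1 = (fps_exp 1 - 1) oo A c"
      by (simp add: exp_series_def A_def fps_compose_sub_distrib)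
    then have "fps_ln 1 oo (exp_series c - 1) = (fps_ln 1 oo (fps_exp 1 - 1)) oo A c"
      by (simp add: fps_compose_assoc A0)
    also have "fps_ln 1 oo (fps_exp 1 - 1) = (fps_X :: rat fps)"
      by (simp add: fps_ln_fps_exp_inv fps_inv_fps_exp_compose)
    finally show ?thesis by (simp add: A0)
  qed
  have "A a $ n = A b $ n" using assms(1) log by metis
  then show ?thesis using assms(2) by (simp add: A_def)
qed

lemma cycle_fixed_points:
  fixes k :: nat
  assumes "k \<ge> 1"
  shows "dynamical_system {..<k} (\<lambda>x. (x + 1) mod k)"
    and "Fix {..<k} (\<lambda>x. (x + 1) mod k) n = (if k dvd n then k else 0)"
proof -
  define T where "T = (\<lambda>x. (x + 1) mod k)"
  have pow: "(T ^^ n) x = (x + n) mod k" if "x < k" for x n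
    using that by (induction n) (simp_all add: T_def mod_simps)
  have "(T ^^ n) x = x \<longleftrightarrow> k dvd n" if x: "x < k" for x n
  proof -
    have "(x + n) mod k = x \<longleftrightarrow> (x + n) mod k = (x + 0) mod k" using x by simp
    also have "\<dots> \<longleftrightarrow> k dvd n"
      by (metis add_diff_cancel_left' add_0_right le_add1 mod_eq_dvd_iff_nat)
    finally show ?thesis using pow[OF x] by simp
  qed
  then have eq: "fixed_points {..<k} T n = (if k dvd n then {..<k} else {})" for n
    by (auto simp: fixed_points_def)
  show "dynamical_system {..<k} (\<lambda>x. (x + 1) mod k)"
    unfolding T_def[symmetric] dynamical_system_def using assms by (auto simp: eq) (auto simp: T_def)
  show "Fix {..<k} (\<lambda>x. (x + 1) mod k) n = (if k dvd n then k else 0)"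
    unfolding T_def[symmetric] by (simp add: Fix_def eq)
qed

lemma time_change_pos:
  assumes "h \<in> posnat \<rightarrow>\<^sub>E posnat" "n \<ge> 1"
  shows "h n \<ge> 1"
  using assms by (auto simp: posnat_def PiE_def Pi_def)

text \<open>
  Apply \<open>h\<close> to a cycle of length \<open>k\<close>, and let \<open>S\<close> realize the result: the \<open>n\<close>th iterate of \<open>S\<close> has
  \<open>k\<close> or \<open>0\<close> fixed points, according to whether \<open>k dvd h n\<close>. If it has \<open>k\<close>, these are the same
  points for all such \<open>n\<close>, because for two such orders the iterate of
  the product order fixes all of them and has no more than
  \<open>k\<close> fixed points. Each of these points has as its least period the least such \<open>n\<close>, say \<open>m\<close>.
  Then \<open>m\<close> divides all such \<open>n\<close>, and it divides \<open>k\<close> because the \<open>k\<close> points fall into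
  orbits of length \<open>m\<close>.
\<close>

lemma time_change_dvd_principal:
  assumes h: "h \<in> time_changes" and k: "k \<ge> 1" and a: "a \<ge> 1" "k dvd h a"
  obtains m where "m dvd k" "\<And>n. n \<ge> 1 \<Longrightarrow> k dvd h n \<longleftrightarrow> m dvd n"
proof -
  define X where "X = {..<k}"
  define T where "T = (\<lambda>x::nat. (x + 1) mod k)"
  have "twisted_zeta h X T \<in> zeta_functions"
    using h cycle_fixed_points(1)[OF k] by (auto simp: time_changes_def X_def T_def)
  then obtain Y :: "nat set" and S
    where YS: "dynamical_system Y S" and z: "twisted_zeta h X T = zeta Y S"
    by (auto simp: zeta_functions_def)
  have card: "card (fixed_points Y S n) = (if k dvd h n then k else 0)" if "n \<ge> 1" for n
    using exp_series_inj[OF z[unfolded twisted_zeta_def zeta_def] that] cycle_fixed_points(2)[OF k]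
    by (simp add: Fix_def X_def T_def split: if_splits)
  have fin: "finite (fixed_points Y S n)" if "n \<ge> 1" for n
    using YS that by (auto simp: dynamical_system_def)
  have mono: "fixed_points Y S d \<subseteq> fixed_points Y S n" if "d dvd n" for d n
    using that funpow_mod_eq[of d S _ n] by (force simp: fixed_points_def mod_eq_0_iff_dvd)
  define m where "m = (LEAST n. n \<ge> 1 \<and> k dvd h n)"
  have m: "m \<ge> 1" "k dvd h m" unfolding m_def using LeastI[of "\<lambda>n. n \<ge> 1 \<and> k dvd h n" a] a by auto
  have m_le: "m \<le> n" if "n \<ge> 1" "k dvd h n" for n
    unfolding m_def using that by (intro Least_le) auto
  have per: "least_power S y = m" if y: "y \<in> fixed_points Y S m" for y
  proof -
    define d where "d = least_power S y"
    have ym: "(S ^^ m) y = y" "y \<in> Y" using y by (auto simp: fixed_points_def)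
    have dm: "d dvd m" unfolding d_def by (rule least_power_minimal[OF ym(1)])
    have d1: "d \<ge> 1" and yd: "y \<in> fixed_points Y S d"
      using least_powerI[OF ym(1)] m ym(2) by (auto simp: d_def fixed_points_def)
    have "card (fixed_points Y S d) > 0" using yd fin[OF d1] by (auto simp: card_gt_0_iff)
    then have "k dvd h d" using card[OF d1] by (auto split: if_splits)
    then have "m \<le> d" using d1 m_le by blast
    then show ?thesis using dm m dvd_imp_le[OF dm] by (simp add: d_def)
  qed
  have ne: "fixed_points Y S m \<noteq> {}" using card[of m] m k by auto
  have iff: "k dvd h n \<longleftrightarrow> m dvd n" if n: "n \<ge> 1" for n
  proof
    assume kn: "k dvd h n"
    have mn: "m * n \<ge> 1" using m n by simp
    have sub: "fixed_points Y S m \<subseteq> fixed_points Y S (m * n)"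
      "fixed_points Y S n \<subseteq> fixed_points Y S (m * n)" by (auto intro!: mono)
    \<comment> \<open>Both sets have \<open>k\<close> elements, and the set containing them has no more than that.\<close>
    have "card (fixed_points Y S (m * n)) \<le> k" using card[OF mn] by simp
    then have "fixed_points Y S m = fixed_points Y S n"
      using sub fin[OF mn] card[OF n] card[OF m(1)] kn m(2) card_seteq by (metis (lifting))
    then obtain y where "y \<in> fixed_points Y S m" "y \<in> fixed_points Y S n" using ne by auto
    then show "m dvd n" using per[of y] least_power_minimal[of n S y] by (auto simp: fixed_points_def)
  next
    assume "m dvd n"
    then have "fixed_points Y S n \<noteq> {}" using mono ne by blast
    then have "card (fixed_points Y S n) > 0" using fin[OF n] by (simp add: card_gt_0_iff)
    then show "k dvd h n" using card[OF n] by (auto split: if_splits)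
  qed
  have "m dvd card (fixed_points Y S m)"
  proof (rule period_dvd_card)
    show "S \<in> fixed_points Y S m \<rightarrow> fixed_points Y S m"
      using YS by (auto simp: fixed_points_def dynamical_system_def funpow_swap1[symmetric])
    show "(S ^^ n) y = y \<longleftrightarrow> m dvd n" if "y \<in> fixed_points Y S m" for y n
      using that per[OF that] m funpow_eq_self_iff_dvd[of m S y n] by (auto simp: fixed_points_def)
  qed (use m fin in auto)
  then have "m dvd k" using card m by simp
  then show thesis using iff that by blast
qed

text \<open>
  Let \<open>m k\<close> be the divisor belonging to \<open>k\<close>. The power \<open>k div m k\<close> of the map turns a point of period
  \<open>k\<close> into a point of period \<open>m k\<close>, which is then fixed by the \<open>n\<close>th iterate iff \<open>k dvd h n\<close>, that is,
  iff the iterate of order \<open>h n\<close> of the original map fixes it. The exponent depends only on the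
  period, so it is constant along orbits. Points whose period divides no value of \<open>h\<close> are discarded.
\<close>

lemma time_change_of_dvd_principal:
  assumes h: "h \<in> posnat \<rightarrow>\<^sub>E posnat"
    and principal: "\<And>k a. k \<ge> 1 \<Longrightarrow> a \<ge> 1 \<Longrightarrow> k dvd h a \<Longrightarrow>
      \<exists>m. m dvd k \<and> (\<forall>n\<ge>1. k dvd h n \<longleftrightarrow> m dvd n)"
  shows "h \<in> time_changes"
proof -
  have "twisted_zeta h X T \<in> zeta_functions" if XT: "dynamical_system X T" for X :: "nat set" and T
  proof -
    have TX: "T \<in> X \<rightarrow> X" using XT by (simp add: dynamical_system_def)
    define m where "m k = (SOME m. m dvd k \<and> (\<forall>n\<ge>1. k dvd h n \<longleftrightarrow> m dvd n))" for k
    have m: "m k dvd k \<and> (\<forall>n\<ge>1. k dvd h n \<longleftrightarrow> m k dvd n)"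
      if "k \<ge> 1" "a \<ge> 1" "k dvd h a" for k a
      unfolding m_def using principal[OF that] by (rule someI_ex)
    define Y where "Y = {x \<in> X. \<exists>a\<ge>1. (T ^^ h a) x = x}"
    define c where "c x = least_power T x div m (least_power T x)" for x
    define S where "S x = (T ^^ c x) x" for x
    have Y: "S x \<in> Y \<and> (\<forall>n\<ge>1. (S ^^ n) x = x \<longleftrightarrow> (T ^^ h n) x = x)" if "x \<in> Y" for x
    proof -
      obtain a where a: "a \<ge> 1" "(T ^^ h a) x = x" and xX: "x \<in> X"
        using \<open>x \<in> Y\<close> by (auto simp: Y_def)
      have ha: "h a > 0" using time_change_pos[OF h a(1)] by simp
      define k where "k = least_power T x"
      have per: "(T ^^ n) x = x \<longleftrightarrow> k dvd n" for n
        unfolding k_def by (rule funpow_eq_self_iff_dvd[OF a(2) ha])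
      have "k dvd h a" using per a(2) by simp
      then have k: "k \<ge> 1" "k dvd h a" using ha by (auto intro: Suc_leI gr0I)
      have mk: "m k dvd k" "\<And>n. n \<ge> 1 \<Longrightarrow> k dvd h n \<longleftrightarrow> m k dvd n"
        using m[OF k(1) a(1) k(2)] by auto
      have kc: "k = m k * c x" using mk(1) by (simp add: c_def k_def[symmetric])
      then have cpos: "c x > 0" using k(1) by (metis gr0I mult_0_right not_one_le_zero)
      have c_orbit: "c ((T ^^ i) x) = c x" for i
        by (simp add: c_def least_power_funpow[OF a(2) ha])
      have S_pow: "(S ^^ n) x = (T ^^ (n * c x)) x" for n
      proof (induction n)
        case (Suc n)
        have "(S ^^ Suc n) x = S ((T ^^ (n * c x)) x)" by (simp add: Suc)
        also have "\<dots> = (T ^^ c x) ((T ^^ (n * c x)) x)" by (simp add: S_def c_orbit)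
        finally show ?case by (simp add: funpow_add)
      qed simp
      have "(S ^^ n) x = x \<longleftrightarrow> (T ^^ h n) x = x" if "n \<ge> 1" for n
      proof -
        have "(S ^^ n) x = x \<longleftrightarrow> k dvd n * c x" by (simp add: S_pow per)
        also have "\<dots> \<longleftrightarrow> m k * c x dvd n * c x" by (subst kc) (rule refl)
        also have "\<dots> \<longleftrightarrow> k dvd h n" using cpos mk(2)[OF that] by simp
        finally show ?thesis by (simp add: per)
      qed
      moreover have "S x \<in> Y"
      proof -
        have "(T ^^ h a) (S x) = (T ^^ (h a + c x)) x" by (simp add: S_def funpow_add)
        also have "\<dots> = S x" by (simp add: S_def funpow_add add.commute[of "h a"] a(2))
        finally show ?thesis using a(1) funpow_in[OF TX xX] by (auto simp: Y_def S_def)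
      qed
      ultimately show ?thesis by blast
    qed
    have "fixed_points Y S n = fixed_points X T (h n)" if "n \<ge> 1" for n
      using Y that by (auto simp: fixed_points_def Y_def)
    moreover have "S \<in> Y \<rightarrow> Y" using Y by blast
    ultimately have "dynamical_system Y S" "twisted_zeta h X T = zeta Y S"
      using XT time_change_pos[OF h]
      by (auto simp: dynamical_system_def zeta_def twisted_zeta_def Fix_def intro!: exp_series_cong)
    then show ?thesis by (auto simp: zeta_functions_def)
  qed
  then show ?thesis using h by (simp add: time_changes_def)
qed

section \<open>Time-changes and valuations\<close>

definition acts_on_valuations :: "(nat \<Rightarrow> nat) \<Rightarrow> (nat \<Rightarrow> nat \<Rightarrow> nat) \<Rightarrow> bool" where
  "acts_on_valuations h F \<longleftrightarrow> h \<in> posnat \<rightarrow>\<^sub>E posnat \<and>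
     (\<forall>n\<ge>1. \<forall>q. prime q \<longrightarrow> multiplicity q (h n) = F q (multiplicity q n))"

text \<open>
  The functions that a time-change can induce on the valuations at one prime: as soon as such a
  function falls below the diagonal it has reached its largest value.
\<close>

definition expanding_until_max :: "(nat \<Rightarrow> nat) \<Rightarrow> bool" where
  "expanding_until_max f \<longleftrightarrow> mono f \<and> (\<forall>a. a \<le> f a \<or> (\<forall>b. f b \<le> f a))"

text \<open>
  If \<open>g a\<close> is the largest value of \<open>g\<close>, then \<open>f (g a)\<close> is the largest value of \<open>f \<circ> g\<close> by monotonicity;
  otherwise \<open>a \<le> g a\<close>, and the condition for \<open>f\<close> at \<open>g a\<close> decides.
\<close>

lemma expanding_until_max_comp:
  assumes "expanding_until_max f" "expanding_until_max g"
  shows "expanding_until_max (f \<circ> g)"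
  unfolding expanding_until_max_def
proof (intro conjI allI)
  have f: "mono f" "\<And>a. a \<le> f a \<or> (\<forall>b. f b \<le> f a)"
    and g: "mono g" "\<And>a. a \<le> g a \<or> (\<forall>b. g b \<le> g a)"
    using assms by (auto simp: expanding_until_max_def)
  show "mono (f \<circ> g)" using f(1) g(1) by (auto simp: mono_def)
  show "a \<le> (f \<circ> g) a \<or> (\<forall>b. (f \<circ> g) b \<le> (f \<circ> g) a)" for a
  proof (cases "a \<le> g a")
    case True
    then show ?thesis using f(2)[of "g a"] by auto
  next
    case False
    then show ?thesis using g(2)[of a] monoD[OF f(1)] by auto
  qed
qed

lemma acts_on_valuations_compose:
  assumes "acts_on_valuations h F" "acts_on_valuations h' F'"
  shows "acts_on_valuations (compose posnat h h') (\<lambda>q. F q \<circ> F' q)"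
proof -
  have "h' n \<ge> 1" if "n \<ge> 1" for n
    using assms(2) that time_change_pos by (simp add: acts_on_valuations_def)
  then show ?thesis
    using assms by (auto simp: acts_on_valuations_def compose_def posnat_def PiE_def Pi_def)
qed

text \<open>
  Let \<open>m\<close> be the least \<open>n\<close> with \<open>k dvd h n\<close>. Since each \<open>F q\<close> is monotone and the valuation of a gcd is
  a minimum, the set of all such \<open>n\<close> is closed under gcds and multiples, hence it consists of the
  multiples of \<open>m\<close>. To obtain \<open>m dvd k\<close> one checks that \<open>gcd m k\<close> belongs to this set too. At a prime
  \<open>q\<close> where the valuation \<open>b\<close> of \<open>k\<close> is smaller than the valuation \<open>a\<close> of \<open>m\<close> this
  amounts to \<open>b \<le> F q b\<close>; if that failed, \<open>F q b\<close> would be maximal, and so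
  \<open>b \<le> F q a \<le> F q b\<close>.
\<close>

lemma time_change_of_valuations:
  assumes h: "acts_on_valuations h F" and F: "\<And>q. prime q \<Longrightarrow> expanding_until_max (F q)"
  shows "h \<in> time_changes"
proof (rule time_change_of_dvd_principal)
  show h_in: "h \<in> posnat \<rightarrow>\<^sub>E posnat" using h by (simp add: acts_on_valuations_def)
  have mult: "multiplicity q (h n) = F q (multiplicity q n)" if "prime q" "n \<ge> 1" for q n
    using h that by (simp add: acts_on_valuations_def)
  have mono: "mono (F q)" if "prime q" for q using F[OF that] by (simp add: expanding_until_max_def)
  have hpos: "h n > 0" if "n \<ge> 1" for n using time_change_pos[OF h_in that] by simp
  fix k a :: nat
  assume k: "k \<ge> 1" and a: "a \<ge> 1" "k dvd h a"
  have dvd_iff: "k dvd h n \<longleftrightarrow> (\<forall>q. prime q \<longrightarrow> multiplicity q k \<le> F q (multiplicity q n))"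
    if "n \<ge> 1" for n
    using dvd_imp_multiplicity_le[of k "h n"] multiplicity_le_imp_dvd[of k "h n"] mult that k hpos[OF that]
    by (metis not_less_zero not_one_le_zero)
  define m where "m = (LEAST n. n \<ge> 1 \<and> k dvd h n)"
  have m: "m \<ge> 1" "k dvd h m" unfolding m_def using LeastI[of "\<lambda>n. n \<ge> 1 \<and> k dvd h n" a] a by auto
  \<comment> \<open>By minimality of \<open>m\<close>, membership of \<open>gcd m n\<close> forces \<open>gcd m n = m\<close>.\<close>
  have dvdI: "m dvd n" if "n \<ge> 1" "k dvd h (gcd m n)" for n
  proof -
    have g: "gcd m n \<ge> 1" using m by (simp add: Suc_le_eq)
    then have "m \<le> gcd m n" unfolding m_def using that(2)[unfolded m_def] by (intro Least_le) auto
    moreover have "gcd m n \<le> m" using m by (auto intro: dvd_imp_le)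
    ultimately show ?thesis by (metis gcd_dvd2 le_antisym)
  qed
  have gcd: "multiplicity q (gcd m n) = min (multiplicity q m) (multiplicity q n)"
    if "prime q" "n \<ge> 1" for q n using that m by (intro multiplicity_gcd) auto
  have g1: "gcd m n \<ge> 1" for n using m by (simp add: Suc_le_eq)
  have "m dvd k"
  proof (rule dvdI[OF k])
    have "multiplicity q k \<le> F q (multiplicity q (gcd m k))" if q: "prime q" for q
    proof -
      let ?a = "multiplicity q m" and ?b = "multiplicity q k"
      have "?b \<le> F q ?a" using dvd_iff[OF m(1)] m(2) q by blast
      moreover have "?b \<le> F q ?b \<or> F q ?a \<le> F q ?b"
        using F[OF q] by (auto simp: expanding_until_max_def)
      ultimately show ?thesis by (simp add: gcd[OF q k] min_def) linarith
    qed
    then show "k dvd h (gcd m k)" using dvd_iff[OF g1] by blast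
  qed
  moreover have "k dvd h n \<longleftrightarrow> m dvd n" if n: "n \<ge> 1" for n
  proof
    assume "k dvd h n"
    then have "k dvd h (gcd m n)"
      using m(2) unfolding dvd_iff[OF m(1)] dvd_iff[OF n] dvd_iff[OF g1]
      by (simp add: gcd[OF _ n] min_def)
    then show "m dvd n" by (rule dvdI[OF n])
  next
    assume "m dvd n"
    then have "multiplicity q m \<le> multiplicity q n" for q using n by (intro dvd_imp_multiplicity_le) auto
    then show "k dvd h n"
      using m(2) unfolding dvd_iff[OF m(1)] dvd_iff[OF n] by (meson mono monoD order_trans)
  qed
  ultimately show "\<exists>m. m dvd k \<and> (\<forall>n\<ge>1. k dvd h n \<longleftrightarrow> m dvd n)" by blast
qed

text \<open>
  For \<open>k = q ^ j\<close> the divisor provided by \<open>time_change_dvd_principal\<close> is some \<open>q ^ i\<close> with \<open>i \<le> j\<close>.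
  So the valuation of \<open>h n\<close> reaches \<open>j\<close> iff that of \<open>n\<close> reaches a threshold \<open>i \<le> j\<close>, unless it never
  reaches \<open>j\<close>. Thresholds make it a monotone function of the valuation of \<open>n\<close>, and the bound
  \<open>i \<le> j\<close> is the expansion property.
\<close>

lemma time_change_acts_on_valuations:
  assumes h: "h \<in> time_changes"
  obtains F where "acts_on_valuations h F" "\<And>q. prime q \<Longrightarrow> expanding_until_max (F q)"
proof
  define F where "F q a = multiplicity q (h (q ^ a))" for q a :: nat
  have h_in: "h \<in> posnat \<rightarrow>\<^sub>E posnat" using h by (simp add: time_changes_def)
  have hpos: "h n > 0" if "n \<ge> 1" for n using time_change_pos[OF h_in that] by simp
  have threshold: "\<exists>i\<le>j. \<forall>n\<ge>1. j \<le> multiplicity q (h n) \<longleftrightarrow> i \<le> multiplicity q n"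
    if q: "prime q" and a: "a \<ge> 1" "j \<le> multiplicity q (h a)" for q j a
  proof -
    have qj: "q ^ j \<ge> 1" using prime_gt_0_nat[OF q] by simp
    have "q ^ j dvd h a" using a by (intro multiplicity_dvd')
    then obtain m where m: "m dvd q ^ j" "\<And>n. n \<ge> 1 \<Longrightarrow> q ^ j dvd h n \<longleftrightarrow> m dvd n"
      using time_change_dvd_principal[OF h qj a(1)] by blast
    then obtain i where i: "i \<le> j" "m = q ^ i" using divides_primepow_nat[OF q] by blast
    have "j \<le> multiplicity q (h n) \<longleftrightarrow> i \<le> multiplicity q n" if "n \<ge> 1" for n
    proof -
      have "\<not> is_unit q" using q by auto
      then show ?thesis
        using m(2)[OF that] hpos[OF that] that power_dvd_iff_le_multiplicity[of n q i]
          power_dvd_iff_le_multiplicity[of "h n" q j] unfolding i(2) by simp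
    qed
    then show ?thesis using i by blast
  qed
  have pow1: "q ^ a \<ge> 1" if "prime q" for q a :: nat using prime_gt_0_nat[OF that] by simp
  have local: "multiplicity q (h n) = F q (multiplicity q n)" if q: "prime q" and n: "n \<ge> 1" for q n
  proof -
    have val: "multiplicity q (q ^ multiplicity q n) = multiplicity q n" using q by simp
    have "j \<le> multiplicity q (h n) \<longleftrightarrow> j \<le> F q (multiplicity q n)" for j
      using threshold[OF q n, of j] threshold[OF q pow1[OF q], of j "multiplicity q n"]
        val pow1[OF q] n unfolding F_def by metis
    then show ?thesis by (meson order_antisym order_refl)
  qed
  show "acts_on_valuations h F" using h_in local by (simp add: acts_on_valuations_def)
  show "expanding_until_max (F q)" if q: "prime q" for q
    unfolding expanding_until_max_def
  proof (intro conjI allI)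
    have val: "multiplicity q (q ^ a) = a" for a using q by simp
    have thr: "\<exists>i\<le>j. \<forall>a. j \<le> F q a \<longleftrightarrow> i \<le> a" if "j \<le> F q b" for j b
      using threshold[OF q pow1[OF q] that[unfolded F_def]] pow1[OF q] val unfolding F_def by metis
    show "mono (F q)"
    proof (rule monoI)
      fix a b :: nat assume "a \<le> b"
      then show "F q a \<le> F q b" using thr[OF order_refl, of a] by (meson order_refl order_trans)
    qed
    show "a \<le> F q a \<or> (\<forall>b. F q b \<le> F q a)" for a
    proof (rule ccontr)
      \<comment> \<open>If \<open>F q a < a\<close> is not maximal, the threshold for \<open>Suc (F q a)\<close> exists and is at most \<open>a\<close>.\<close>
      assume "\<not> ?thesis"
      then obtain b where "Suc (F q a) \<le> a" "Suc (F q a) \<le> F q b" by (auto simp: not_le Suc_le_eq)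
      then show False using thr[of "Suc (F q a)" b] by (metis Suc_n_not_le_n order_trans)
    qed
  qed
qed

section \<open>The generated monoid\<close>

lemma g_map_acts_on_valuations:
  assumes "prime p"
  shows "acts_on_valuations (g_map p t) ((\<lambda>_. id)(p := id(t := Suc t)))"
  unfolding acts_on_valuations_def
proof (intro conjI allI impI)
  have p: "p > 0" using prime_gt_0_nat[OF assms] .
  show "g_map p t \<in> posnat \<rightarrow>\<^sub>E posnat" using p by (auto simp: g_map_def posnat_def)
  fix n q :: nat assume n: "n \<ge> 1" and q: "prime q"
  have "multiplicity q (p * n) = (if q = p then Suc (multiplicity p n) else multiplicity q n)"
    using assms q n p
    by (auto simp: prime_elem_multiplicity_mult_distrib prime_multiplicity_other)
  then show "multiplicity q (g_map p t n) =
      ((\<lambda>_. id)(p := id(t := Suc t))) q (multiplicity q n)"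
    using n by (auto simp: g_map_def posnat_def)
qed

lemma h_map_acts_on_valuations:
  assumes "prime p"
  shows "acts_on_valuations (h_map p t) ((\<lambda>_. id)(p := min t))"
  unfolding acts_on_valuations_def
proof (intro conjI allI impI)
  have p: "p > 0" using prime_gt_0_nat[OF assms] .
  have quot: "n = p ^ (multiplicity p n - t) * (n div p ^ (multiplicity p n - t))" for n
    by (simp add: multiplicity_dvd')
  have quot_pos: "n div p ^ (multiplicity p n - t) > 0" if "n \<ge> 1" for n
    using quot[of n] that by (metis gr0I mult_0_right not_one_le_zero)
  show "h_map p t \<in> posnat \<rightarrow>\<^sub>E posnat"
    using quot_pos by (auto simp: h_map_def posnat_def Suc_le_eq)
  fix n q :: nat assume n: "n \<ge> 1" and q: "prime q"
  define r where "r = n div p ^ (multiplicity p n - t)"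
  have "multiplicity q n = multiplicity q (p ^ (multiplicity p n - t) * r)"
    using quot[of n] by (simp add: r_def)
  also have "\<dots> = multiplicity q (p ^ (multiplicity p n - t)) + multiplicity q r"
    using q p quot_pos[OF n] by (intro prime_elem_multiplicity_mult_distrib) (auto simp: r_def)
  also have "multiplicity q (p ^ (multiplicity p n - t)) = (if q = p then multiplicity p n - t else 0)"
    using assms q by (auto simp: multiplicity_distinct_prime_power)
  finally show "multiplicity q (h_map p t n) =
      ((\<lambda>_. id)(p := min t)) q (multiplicity q n)"
    using n by (auto simp: h_map_def posnat_def r_def[symmetric] min_def)
qed

lemma generators_subset: "time_change_generators \<subseteq> time_changes"
proof -
  have id: "expanding_until_max id"
    and g: "expanding_until_max (id(t := Suc t))" and h: "expanding_until_max (min t)" for t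
    by (auto simp: expanding_until_max_def mono_def)
  have "g_map p t \<in> time_changes" "h_map p t \<in> time_changes" if "prime p" for p t
    by (rule time_change_of_valuations[OF g_map_acts_on_valuations[OF that]], simp add: id g)
       (rule time_change_of_valuations[OF h_map_acts_on_valuations[OF that]], simp add: id h)
  then show ?thesis by (auto simp: time_change_generators_def)
qed

lemma id_acts_on_valuations: "acts_on_valuations (\<lambda>n\<in>posnat. n) (\<lambda>_. id)"
  by (auto simp: acts_on_valuations_def posnat_def)

lemma submonoid_time_changes: "submonoid time_changes time_change_monoid"
proof
  show "x \<otimes>\<^bsub>time_change_monoid\<^esub> y \<in> time_changes" if x: "x \<in> time_changes" and y: "y \<in> time_changes" for x y
  proof -
    obtain F where F: "acts_on_valuations x F" "\<And>q. prime q \<Longrightarrow> expanding_until_max (F q)"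
      using time_change_acts_on_valuations[OF x] by blast
    obtain G where G: "acts_on_valuations y G" "\<And>q. prime q \<Longrightarrow> expanding_until_max (G q)"
      using time_change_acts_on_valuations[OF y] by blast
    show ?thesis unfolding time_change_monoid_def
      using time_change_of_valuations[OF acts_on_valuations_compose[OF F(1) G(1)]]
        expanding_until_max_comp[OF F(2) G(2)] by simp
  qed
  have "expanding_until_max id" by (auto simp: expanding_until_max_def mono_def)
  then show "\<one>\<^bsub>time_change_monoid\<^esub> \<in> time_changes"
    using time_change_of_valuations[OF id_acts_on_valuations] by (simp add: time_change_monoid_def)
qed (simp add: time_change_monoid_def)

text \<open>
  A hull is a submonoid only if some submonoid contains the generators; the monoid of all
  time-changes is one.
\<close>

lemma submonoid_generated: "submonoid generated_time_changes time_change_monoid"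
proof -
  have sub: "generated_time_changes \<subseteq> time_changes"
    unfolding generated_time_changes_def
    using generators_subset submonoid_time_changes by (rule hull_minimal)
  then show ?thesis
    unfolding generated_time_changes_def hull_def submonoid_def
    by (auto simp: time_change_monoid_def)
qed

lemma generated_compose:
  "x \<in> generated_time_changes \<Longrightarrow> y \<in> generated_time_changes \<Longrightarrow>
    compose posnat x y \<in> generated_time_changes"
  using submonoid.m_closed[OF submonoid_generated] by (simp add: time_change_monoid_def)

lemma generated_one: "(\<lambda>n\<in>posnat. n) \<in> generated_time_changes"
  using submonoid.one_closed[OF submonoid_generated] by (simp add: time_change_monoid_def)

lemma generated_generators:
  assumes "prime p"
  shows "g_map p t \<in> generated_time_changes" "h_map p t \<in> generated_time_changes"
  using hull_subset[of time_change_generators "\<lambda>H. submonoid H time_change_monoid"] assms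
  by (auto simp: generated_time_changes_def time_change_generators_def)

section \<open>Approximation by the generated monoid\<close>

text \<open>
  The functions on valuations that the generated monoid realizes at \<open>p\<close> while leaving the
  valuations at all other primes alone.
\<close>

definition generated_at :: "nat \<Rightarrow> (nat \<Rightarrow> nat) \<Rightarrow> bool" where
  "generated_at p f \<longleftrightarrow>
     (\<exists>w\<in>generated_time_changes. acts_on_valuations w ((\<lambda>_. id)(p := f)))"

lemma generated_at_comp:
  assumes "generated_at p f" "generated_at p g"
  shows "generated_at p (f \<circ> g)"
proof -
  obtain v w where v: "v \<in> generated_time_changes" "acts_on_valuations v ((\<lambda>_. id)(p := f))"
    and w: "w \<in> generated_time_changes" "acts_on_valuations w ((\<lambda>_. id)(p := g))"
    using assms by (auto simp: generated_at_def)
  have "(\<lambda>q. ((\<lambda>_. id)(p := f)) q \<circ> ((\<lambda>_. id)(p := g)) q) = (\<lambda>_. id)(p := f \<circ> g)"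
    by auto
  then show ?thesis
    using acts_on_valuations_compose[OF v(2) w(2)] generated_compose[OF v(1) w(1)]
    unfolding generated_at_def by auto
qed

lemma generated_at_id: "generated_at p id"
proof -
  have "acts_on_valuations (\<lambda>n\<in>posnat. n) ((\<lambda>_. id)(p := id))"
    by (rule back_subst[of "acts_on_valuations _", OF id_acts_on_valuations]) auto
  then show ?thesis using generated_one unfolding generated_at_def by blast
qed

text \<open>
  Successive unit steps at \<open>c, \<dots>, d - 1\<close> carry \<open>c\<close> to \<open>d\<close>. They collapse the values in between, but
  nothing below \<open>c\<close> or from \<open>d\<close> on moves.
\<close>

lemma generated_at_lift:
  assumes "prime p" "c \<le> d"
  shows "\<exists>f. generated_at p f \<and> f c = d \<and> (\<forall>a. a < c \<or> d \<le> a \<longrightarrow> f a = a)"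
  using assms(2)
proof (induction d rule: dec_induct)
  case base
  show ?case by (intro exI[of _ id] conjI generated_at_id) auto
next
  case (step d)
  then obtain f where f: "generated_at p f" "f c = d" "\<And>a. a < c \<or> d \<le> a \<Longrightarrow> f a = a" by blast
  have "generated_at p (id(d := Suc d))"
    unfolding generated_at_def
    using generated_generators(1)[OF assms(1)] g_map_acts_on_valuations[OF assms(1)] by blast
  then have "generated_at p (id(d := Suc d) \<circ> f)" using f(1) by (rule generated_at_comp)
  moreover have "(id(d := Suc d) \<circ> f) c = Suc d" using f(2) by simp
  moreover have "(id(d := Suc d) \<circ> f) a = a" if "a < c \<or> Suc d \<le> a" for a
    using that f(3)[of a] step.hyps by auto
  ultimately show ?case by blast
qed

text \<open>
  The arguments \<open>M, M - 1, \<dots>, 0\<close> are lifted to their values in this order. When the turn comes to \<open>k\<close>,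
  the larger arguments already sit at values that are at least \<open>r k\<close>, and the smaller ones have not
  moved; lifting \<open>k\<close> to \<open>r k\<close> disturbs neither.
\<close>

lemma generated_at_expanding:
  assumes "prime p" "mono r" and exp: "\<And>a. a \<le> M \<Longrightarrow> a \<le> r a"
  shows "\<exists>f. generated_at p f \<and> (\<forall>a\<le>M. f a = r a)"
proof -
  have "\<exists>f. generated_at p f \<and> (\<forall>a\<le>M. f a = (if a < k then a else r a))" if "k \<le> Suc M" for k
    using that
  proof (induction k rule: inc_induct)
    case base
    show ?case by (intro exI[of _ id] conjI generated_at_id) auto
  next
    case (step k)
    then obtain f where f: "generated_at p f" "\<And>a. a \<le> M \<Longrightarrow> f a = (if a < Suc k then a else r a)"
      by blast
    obtain l where l: "generated_at p l" "l k = r k" "\<And>a. a < k \<or> r k \<le> a \<Longrightarrow> l a = a"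
      using generated_at_lift[OF assms(1) exp[of k]] step.hyps by auto
    have "(l \<circ> f) a = (if a < k then a else r a)" if a: "a \<le> M" for a
    proof -
      consider "a < k" | "a = k" | "k < a" by linarith
      then show ?thesis using f(2)[OF a] l(2,3) monoD[OF assms(2), of k a] by cases auto
    qed
    then show ?case using generated_at_comp[OF l(1) f(1)] by blast
  qed
  from this[of 0] show ?thesis by auto
qed

text \<open>
  If \<open>F\<close> is expanding up to \<open>N\<close>, lifting suffices. Otherwise some \<open>F a\<^sub>0 < a\<^sub>0\<close> is the largest value \<open>J\<close>
  of \<open>F\<close>. Then \<open>F\<close> is still expanding on \<open>{..J}\<close>, and it is constantly \<open>J\<close> from \<open>J\<close> on, so that
  \<open>F = F \<circ> min J\<close>.
\<close>

lemma generated_at_approx: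
  assumes p: "prime p" and F: "expanding_until_max F"
  shows "\<exists>f. generated_at p f \<and> (\<forall>a\<le>N. f a = F a)"
proof (cases "\<forall>a\<le>N. a \<le> F a")
  case True
  then show ?thesis using generated_at_expanding[OF p, of F N] F by (auto simp: expanding_until_max_def)
next
  case False
  then obtain a\<^sub>0 where "F a\<^sub>0 < a\<^sub>0" by (auto simp: not_le)
  define J where "J = F a\<^sub>0"
  have mono: "mono F" and dich: "\<And>a. a \<le> F a \<or> (\<forall>b. F b \<le> F a)"
    using F by (auto simp: expanding_until_max_def)
  have max: "F b \<le> J" for b using dich[of a\<^sub>0] \<open>F a\<^sub>0 < a\<^sub>0\<close> by (auto simp: J_def)
  have exp: "a \<le> F a" if "a \<le> J" for a using dich[of a] that unfolding J_def by (meson order_trans)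
  obtain f where f: "generated_at p f" "\<And>a. a \<le> J \<Longrightarrow> f a = F a"
    using generated_at_expanding[OF p mono exp] by blast
  have "generated_at p (min J)"
    unfolding generated_at_def
    using generated_generators(2)[OF p] h_map_acts_on_valuations[OF p] by blast
  then have "generated_at p (f \<circ> min J)" using f(1) by (intro generated_at_comp)
  moreover have "(f \<circ> min J) a = F a" for a
  proof (cases "a \<le> J")
    case True
    then show ?thesis using f(2) by (simp add: min_def)
  next
    case False
    then have "F J \<le> F a" using monoD[OF mono] by simp
    then show ?thesis using False f(2)[of J] exp[of J] max[of J] max[of a] by (simp add: min_def)
  qed
  ultimately show ?thesis by blast
qed

text \<open>
  The elements found for the single primes act independently of one another, so they can be composed
  in any order.
\<close>

lemma generated_approx_primes:
  assumes "finite P" "\<And>p. p \<in> P \<Longrightarrow> prime p" "\<And>p. prime p \<Longrightarrow> expanding_until_max (F p)"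
  shows "\<exists>w\<in>generated_time_changes. \<exists>G. acts_on_valuations w G \<and>
    (\<forall>q. \<forall>a\<le>N. G q a = (if q \<in> P then F q a else a))"
  using assms(1,2)
proof (induction P rule: finite_induct)
  case empty
  show ?case by (intro bexI[OF _ generated_one] exI conjI, rule id_acts_on_valuations) simp
next
  case (insert p P)
  then obtain w G where w: "w \<in> generated_time_changes" "acts_on_valuations w G"
    and G: "\<And>q a. a \<le> N \<Longrightarrow> G q a = (if q \<in> P then F q a else a)" by auto
  obtain f v where f: "\<And>a. a \<le> N \<Longrightarrow> f a = F p a"
    and v: "v \<in> generated_time_changes" "acts_on_valuations v ((\<lambda>_. id)(p := f))"
    using generated_at_approx[of p "F p" N] insert.prems assms(3) by (auto simp: generated_at_def)
  have "(((\<lambda>_. id)(p := f)) q \<circ> G q) a = (if q \<in> insert p P then F q a else a)" if "a \<le> N" for q a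
    using G[OF that] f[OF that] insert.hyps by auto
  then show ?case
    using generated_compose[OF v(1) w(1)] acts_on_valuations_compose[OF v(2) w(2)] by blast
qed

text \<open>
  A prime \<open>q\<close> greater than \<open>N\<close> and \<open>h 1\<close> divides neither \<open>n\<close> nor \<open>h 1\<close>. Since the valuation of \<open>h n\<close> at
  \<open>q\<close> depends only on that of \<open>n\<close>, it is the same as for \<open>h 1\<close>, namely \<open>0\<close>. This leaves finitely
  many primes, at which the valuation of \<open>n\<close> is at most \<open>N\<close>.
\<close>

lemma generated_agrees_up_to:
  assumes "h \<in> time_changes"
  obtains w where "w \<in> generated_time_changes" "\<And>n. 1 \<le> n \<Longrightarrow> n \<le> N \<Longrightarrow> w n = h n"
proof -
  obtain F where h: "acts_on_valuations h F" and F: "\<And>q. prime q \<Longrightarrow> expanding_until_max (F q)"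
    using time_change_acts_on_valuations[OF assms] by blast
  define P where "P = {p. prime p \<and> p \<le> max N (h 1)}"
  have prime_P: "prime p" if "p \<in> P" for p using that by (simp add: P_def)
  have "finite P" unfolding P_def by (rule finite_subset[of _ "{..max N (h 1)}"]) auto
  then obtain w G where w: "w \<in> generated_time_changes" "acts_on_valuations w G"
    and G: "\<And>q a. a \<le> N \<Longrightarrow> G q a = (if q \<in> P then F q a else a)"
    using generated_approx_primes[OF \<open>finite P\<close>, of F N] prime_P F by blast
  have val: "multiplicity q (h n) = F q (multiplicity q n)" "multiplicity q (w n) = G q (multiplicity q n)"
    if "n \<ge> 1" "prime q" for q n
    using h w(2) that by (auto simp: acts_on_valuations_def)
  have pos: "h n > 0" "w n > 0" if "n \<ge> 1" for n
    using h w(2) that time_change_pos[of h n] time_change_pos[of w n]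
    by (auto simp: acts_on_valuations_def)
  have "w n = h n" if n: "1 \<le> n" "n \<le> N" for n
  proof (rule multiplicity_eq_nat)
    fix q :: nat assume q: "prime q"
    have "multiplicity q n < q ^ multiplicity q n"
      using prime_gt_1_nat[OF q] by (intro power_gt_expt) simp
    also have "\<dots> \<le> n" using n by (auto intro: dvd_imp_le multiplicity_dvd)
    finally have le: "multiplicity q n \<le> N" using n by simp
    show "multiplicity q (w n) = multiplicity q (h n)"
    proof (cases "q \<in> P")
      case True
      then show ?thesis using val[OF n(1) q] G[OF le] by simp
    next
      case False
      then have "q > n" "q > h 1" using q n by (auto simp: P_def)
      then have "multiplicity q n = 0" "multiplicity q (h 1) = 0"
        using n pos[of 1] by (auto intro!: not_dvd_imp_multiplicity_0 dest: dvd_imp_le)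
      then show ?thesis using val[OF n(1) q] val(1)[of 1 q] q G[OF le, of q] False by simp
    qed
  qed (use pos n in auto)
  then show thesis using w(1) that by blast
qed

text \<open>
  A basic neighbourhood of \<open>h\<close> in the product topology constrains only finitely many coordinates, so
  agreement with \<open>h\<close> on an initial segment puts an element of the generated monoid into it.
\<close>

theorem theorem14:
  shows "submonoid generated_time_changes time_change_monoid \<and>
    time_change_topology closure_of generated_time_changes = time_changes"
proof
  show "submonoid generated_time_changes time_change_monoid" by (rule submonoid_generated)
  have top: "topspace time_change_topology = time_changes"
    by (auto simp: time_change_topology_def time_changes_def)
  have "\<exists>w\<in>generated_time_changes. w \<in> V" if h: "h \<in> V" and V: "openin time_change_topology V" for h V
  proof -
    obtain W where W: "openin (product_topology (\<lambda>_. discrete_topology posnat) posnat) W"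
      and VW: "V = W \<inter> time_changes"
      using V by (auto simp: time_change_topology_def openin_subtopology)
    then obtain U where U: "finite {i \<in> posnat. U i \<noteq> posnat}" "h \<in> Pi\<^sub>E posnat U" "Pi\<^sub>E posnat U \<subseteq> W"
      using h by (auto simp: openin_product_topology_alt)
    obtain N where N: "\<And>i. i \<in> posnat \<Longrightarrow> U i \<noteq> posnat \<Longrightarrow> i \<le> N"
      using U(1) by (metis (mono_tags, lifting) finite_nat_set_iff_bounded_le mem_Collect_eq)
    obtain w where w: "w \<in> generated_time_changes" "\<And>n. 1 \<le> n \<Longrightarrow> n \<le> N \<Longrightarrow> w n = h n"
      using generated_agrees_up_to[of h N] h VW by auto
    have wt: "w \<in> time_changes"
      using w(1) submonoid.subset[OF submonoid_generated] by (auto simp: time_change_monoid_def)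
    have "w i \<in> U i" if i: "i \<in> posnat" for i
    proof (cases "U i = posnat")
      case True
      then show ?thesis using wt i by (auto simp: time_changes_def)
    next
      case False
      then have "w i = h i" using N[OF i] w(2) i by (auto simp: posnat_def)
      then show ?thesis using U(2) i by auto
    qed
    moreover have "w \<in> extensional posnat" using wt by (auto simp: time_changes_def PiE_def)
    ultimately have "w \<in> Pi\<^sub>E posnat U" by (auto simp: PiE_def)
    then show ?thesis using U(3) VW w(1) wt by blast
  qed
  then show "time_change_topology closure_of generated_time_changes = time_changes"
    using top by (auto simp: closure_of_def)
qed

end
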